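(* Let $\rho\in\mathbb{C}$ with $|\rho|<1$, let $x\in(0,\infty)$, let $\gamma\in\mathbb{C}$, and let $a,b,c,d>0$ except for possibly a pair of complex conjugates with positive real parts among $a,b,c$ and among $a,b,d$. Then $$ (1-\rho)^{-\gamma}\ {}_3F_2\!\left(\begin{matrix}\gamma,\ a+ix,\ a-ix\\ a+b,\ a+c\end{matrix};\frac{\rho}{\rho-1}\right) =\sum_{k=0}^\infty \frac{(\gamma)_k\,\rho^k}{(a+b)_k\,(a+c)_k\,k!}\ {}_2F_1\!\left(\begin{matrix}c-d,\ \gamma+k\\ k+a+c\end{matrix};\rho\right)S_k(x^2;a,b,d). $$
   Context: The Pochhammer symbol is $(z)_n=\prod_{i=1}^n(z+i-1)$ (so $(z)_0=1$). The generalized hypergeometric function is ${}_pF_q(a_1,\dots,a_p;b_1,\dots,b_q;z)=\sum_{n\ge0}\frac{(a_1)_n\cdots(a_p)_n}{(b_1)_n\cdots(b_q)_n}\frac{z^n}{n!}$; for $p=q+1$ it is continued analytically from $|z|<1$ to $\mathbb{C}\setminus[1,\infty)$. Powers of $1-\rho$ are taken with the principal branch. The continuous dual Hahn polynomials are $$S_n(x^2;a,b,c)=(a+b)_n(a+c)_n\ {}_3F_2\!\left(\begin{matrix}-n,\ a+ix,\ a-ix\\ a+b,\ a+c\end{matrix};1\right).$$ The parameter hypothesis means: all parameters have positive real part, and in each of the lists $a,b,c$ and $a,b,d$ the non-real entries (if any) form a complex conjugate pair. *)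

theory Defs
  imports "HOL-Complex_Analysis.Complex_Analysis"
begin

text \<open>
  The coefficients of \<open>fps_hypergeo as bs 1\<close> are exactly the quotients
  $(a_1)_n \cdots (a_p)_n / ((b_1)_n \cdots (b_q)_n\, n!)$, so evaluating it gives the defining series.
\<close>

abbreviation hypergeo_series :: "complex list \<Rightarrow> complex list \<Rightarrow> complex \<Rightarrow> complex" where
  "hypergeo_series as bs z \<equiv> eval_fps (fps_hypergeo as bs 1) z"

abbreviation hypergeo_slit_plane :: "complex set" where
  "hypergeo_slit_plane \<equiv> - (complex_of_real ` {1..})"

definition is_hypergeo_continuation ::
    "complex list \<Rightarrow> complex list \<Rightarrow> (complex \<Rightarrow> complex) \<Rightarrow> bool" where
  "is_hypergeo_continuation as bs f \<longleftrightarrow>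
     f holomorphic_on hypergeo_slit_plane \<and>
     (\<forall>z. norm z < 1 \<longrightarrow> f z = hypergeo_series as bs z)"

text \<open>
  For \<open>p = q + 1\<close> and \<open>norm z \<ge> 1\<close> the value on the slit plane is that of the analytic
  continuation. Inside the unit disc, for \<open>p \<noteq> q + 1\<close>, and on the cut (for instance a terminating
  series at \<open>z = 1\<close>) it is the value of the series itself. The continuation is unique on the slit
  plane (see \<open>hypergeo_eqI\<close> below), so the choice operator is harmless there.
\<close>

definition hypergeo :: "complex list \<Rightarrow> complex list \<Rightarrow> complex \<Rightarrow> complex" where
  "hypergeo as bs z =
     (if length as = Suc (length bs) \<and> norm z \<ge> 1 \<and> z \<in> hypergeo_slit_plane
      then (SOME f. is_hypergeo_continuation as bs f) z
      else hypergeo_series as bs z)"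

text \<open>
  \<open>cont_dual_hahn n x a b c\<close> is $S_n(x^2; a, b, c)$: the argument is \<open>x\<close>, not \<open>x\<^sup>2\<close>.
\<close>

definition cont_dual_hahn ::
    "nat \<Rightarrow> complex \<Rightarrow> complex \<Rightarrow> complex \<Rightarrow> complex \<Rightarrow> complex" where
  "cont_dual_hahn n x a b c =
     pochhammer (a + b) n * pochhammer (a + c) n *
     hypergeo [- of_nat n, a + \<i> * x, a - \<i> * x] [a + b, a + c] 1"

definition real_or_cnj_pair :: "complex \<Rightarrow> complex \<Rightarrow> complex \<Rightarrow> bool" where
  "real_or_cnj_pair a b c \<longleftrightarrow>
     (a \<in> \<real> \<and> b \<in> \<real> \<and> c \<in> \<real>) \<or>
     (a \<in> \<real> \<and> c = cnj b) \<or> (b \<in> \<real> \<and> c = cnj a) \<or> (c \<in> \<real> \<and> b = cnj a)"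

lemma hypergeo_series_sum:
  "hypergeo_series as bs z =
     (\<Sum>n. prod_list (map (\<lambda>a. pochhammer a n) as) /
           prod_list (map (\<lambda>b. pochhammer b n) bs) * (z ^ n / fact n))"
proof -
  have "foldl (\<lambda>r a. r * pochhammer a n) v as = v * prod_list (map (\<lambda>a. pochhammer a n) as)"
    for n and v :: complex and as
    by (induction as arbitrary: v) (auto simp: mult.assoc)
  then show ?thesis
    by (simp add: eval_fps_def)
qed

lemma hypergeo_continuation_unique:
  assumes "is_hypergeo_continuation as bs f" "is_hypergeo_continuation as bs g"
    and "z \<in> hypergeo_slit_plane"
  shows "f z = g z"
proof (rule analytic_continuation_open[of "ball 0 1" hypergeo_slit_plane f g])
  have "closed (complex_of_real ` {1..})"
    by (intro closed_injective_linear_image) (auto intro: linear_of_real inj_of_real)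
  then show "open hypergeo_slit_plane"
    by (simp add: open_Compl)
  show "connected hypergeo_slit_plane"
    by (intro starlike_imp_connected starlike_slotted_complex_plane_right)
qed (use assms in \<open>auto simp: is_hypergeo_continuation_def\<close>)

lemma hypergeo_eqI:
  assumes f: "is_hypergeo_continuation as bs f"
    and "length as = Suc (length bs)" and z: "z \<in> hypergeo_slit_plane"
  shows "hypergeo as bs z = f z"
proof (cases "norm z < 1")
  case True
  then show ?thesis
    using f by (simp add: hypergeo_def is_hypergeo_continuation_def)
next
  case False
  have "is_hypergeo_continuation as bs (SOME f. is_hypergeo_continuation as bs f)"
    using someI[of "is_hypergeo_continuation as bs", OF f] .
  then show ?thesis
    using False assms hypergeo_continuation_unique[OF _ f z] by (simp add: hypergeo_def)
qed

end

theory Submission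
  imports Defs
begin

text \<open>
  Put $v^e_m = (a+ix)_m (a-ix)_m / ((a+b)_m (a+e)_m)$ and
  $P^e_n = \sum_m (-n)_m v^e_m / m!$, so that $S_n(x^2; a,b,d) = (a+b)_n (a+d)_n P^d_n$. Expanding in
  powers of \<open>\<rho>\<close>, the left-hand side is $\sum_n (\gamma)_n P^c_n \rho^n / n!$, and the right-hand side is a double
  series whose diagonal sums agree with this by the Chu--Vandermonde identity.

  The analytic content is that both expansions converge for all $|\rho| < 1$. A power series that
  continues to the slit plane still does so after its coefficients are multiplied by $(p)_n / (q)_n$
  with $0 < \mathrm{Re}\, p < \mathrm{Re}\, q$ (Euler integral), so the ${}_3F_2$ in question continues to
  the slit plane. Since $s \mapsto s/(s-1)$ maps the unit disc into the slit plane,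
  $\sum_n (\delta)_n P^e_n s^n / n!$ converges there for every $\delta$; the case $\delta = a + d$, $e = d$ gives the
  absolute convergence of the double series.
\<close>

section \<open>Moments of the beta density on the unit interval\<close>

text \<open>Polynomials are orthogonal to \<open>u\<close> and approximate it uniformly, so the
  integral of \<open>u t * u t\<close> is arbitrarily small. Bernstein polynomials serve as
  approximants; expanding them into monomials reduces their orthogonality to
  \<open>mom\<close>.\<close>

lemma continuous_vanishing_moments:
  fixes u :: "real \<Rightarrow> real"
  assumes u: "continuous_on {0..1} u" and mom: "\<And>n. integral {0..1} (\<lambda>t. t ^ n * u t) = 0"
    and t: "t \<in> {0..1}"
  shows "u t = 0"
proof -
  have int: "(\<lambda>t. f t * u t) integrable_on {0..1}" if "continuous_on {0..1} f" for f :: "real \<Rightarrow> real"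
    by (intro integrable_continuous_real continuous_intros that u)
  have bern: "integral {0..1} (\<lambda>t. Bernstein n k t * u t) = 0" for n k
  proof -
    have "Bernstein n k t = (\<Sum>j\<le>n-k. real (n choose k) * real ((n-k) choose j) * (-1) ^ j * t ^ (k + j))" for t
    proof -
      have "(1 - t) ^ (n - k) = (\<Sum>j\<le>n-k. real ((n-k) choose j) * (-t) ^ j)"
        using binomial_ring[of "-t" 1 "n-k"] by simp
      then show ?thesis
        unfolding Bernstein_def
        by (simp add: sum_distrib_left power_add power_minus[of t] mult_ac)
    qed
    then have "(\<lambda>t. Bernstein n k t * u t) =
        (\<lambda>t. \<Sum>j\<le>n-k. (real (n choose k) * real ((n-k) choose j) * (-1) ^ j) * (t ^ (k + j) * u t))"
      by (simp add: sum_distrib_right mult.assoc)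
    then show ?thesis
      by (simp add: integral_sum integrable_on_cmult_left int continuous_intros mom
          integrable_on_mult_right)
  qed
  obtain B where B: "\<And>t. t \<in> {0..1} \<Longrightarrow> \<bar>u t\<bar> \<le> B" "B > 0"
    using compact_imp_bounded[OF compact_continuous_image[OF u compact_Icc]]
    unfolding bounded_pos by (metis imageI real_norm_def)
  have "integral {0..1} (\<lambda>t. u t * u t) \<le> e" if "e > 0" for e
  proof -
    \<comment> \<open>Since \<open>B\<close> bounds \<open>\<bar>u t\<bar>\<close>, an approximation
      error below \<open>e / B\<close> keeps \<open>(u t - p t) * u t\<close> below
      \<open>e\<close>.\<close>
    have "e / B > 0" using that B by simp
    then obtain N where N: "\<And>n t. N \<le> n \<Longrightarrow> t \<in> {0..1} \<Longrightarrow>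
        \<bar>u t - (\<Sum>k\<le>n. u (k/n) * Bernstein n k t)\<bar> < e / B"
      using Bernstein_Weierstrass[OF u] by blast
    define p where "p t = (\<Sum>k\<le>N. u (k/N) * Bernstein N k t)" for t
    have p: "continuous_on {0..1} p"
      unfolding p_def Bernstein_def by (intro continuous_intros)
    have "continuous_on {0..1} (Bernstein n k)" for n k
      unfolding Bernstein_def by (intro continuous_intros)
    then have "(\<lambda>t. u (k/N) * (Bernstein N k t * u t)) integrable_on {0..1}" for k
      by (intro integrable_on_mult_right int)
    then have "integral {0..1} (\<lambda>t. \<Sum>k\<le>N. u (k/N) * (Bernstein N k t * u t)) =
        (\<Sum>k\<le>N. integral {0..1} (\<lambda>t. u (k/N) * (Bernstein N k t * u t)))"
      by (rule integral_sum[OF finite_atMost])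
    then have "integral {0..1} (\<lambda>t. p t * u t) = 0"
      by (simp only: p_def sum_distrib_right mult.assoc integral_mult_right bern) simp
    then have "integral {0..1} (\<lambda>t. u t * u t) = integral {0..1} (\<lambda>t. (u t - p t) * u t)"
      by (simp add: left_diff_distrib integral_diff int p u)
    also have "\<dots> \<le> integral {0..1} (\<lambda>t::real. e)"
    proof (rule integral_le)
      show "(\<lambda>t. (u t - p t) * u t) integrable_on {0..1}"
        by (intro int continuous_intros p u)
      fix t :: real assume t: "t \<in> {0..1}"
      have "(u t - p t) * u t \<le> \<bar>u t - p t\<bar> * \<bar>u t\<bar>"
        by (metis abs_ge_self abs_mult)
      also have "\<dots> \<le> e / B * B"
        using N[OF order.refl t] B t by (intro mult_mono) (auto simp: p_def)
      finally show "(u t - p t) * u t \<le> e" using B by simp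
    qed auto
    finally show ?thesis by simp
  qed
  then have "integral {0..1} (\<lambda>t. u t * u t) \<le> 0"
    by (rule field_le_epsilon) simp_all
  moreover have "integral {0..1} (\<lambda>t. u t * u t) \<ge> 0"
    by (intro integral_nonneg int u) auto
  ultimately have "integral {0..1} (\<lambda>t. u t * u t) = 0" by simp
  moreover have "integral {0..1} (\<lambda>t. u t * u t) = 0 \<longleftrightarrow> (\<forall>t\<in>{0..1}. u t * u t = 0)"
    by (intro integral_eq_0_iff continuous_intros u) auto
  ultimately show ?thesis using t by simp
qed

text \<open>The integrand of Euler's beta function. As \<open>0 powr z = 0\<close>, it is 0 at both
  endpoints, hence continuous on [0,1] once both real parts exceed 1.\<close>

definition beta_weight :: "complex \<Rightarrow> complex \<Rightarrow> real \<Rightarrow> complex" where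
  "beta_weight p q t = of_real t powr (p - 1) * of_real (1 - t) powr (q - 1)"

lemma continuous_on_beta_weight:
  assumes "Re p > 1" "Re q > 1"
  shows "continuous_on {0..1} (beta_weight p q)"
  unfolding beta_weight_def using assms
  by (intro continuous_intros continuous_on_powr_complex) auto

text \<open>Integrate the derivative of t^(n+p) (1-t)^q, a function that vanishes at both
  endpoints.\<close>

lemma beta_moment_rec:
  assumes p: "Re p > 1" and q: "Re q > 1"
  shows "(p + q + of_nat n) * integral {0..1} (\<lambda>t. of_real t ^ Suc n * beta_weight p q t) =
         (p + of_nat n) * integral {0..1} (\<lambda>t. of_real t ^ n * beta_weight p q t)"
proof -
  let ?w = "beta_weight p q"
  define h where "h = (\<lambda>t. complex_of_real t ^ n * (of_real t powr p * of_real (1 - t) powr q))"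
  define h' where "h' = (\<lambda>t. (p + of_nat n) * (of_real t ^ n * ?w t) -
      (p + q + of_nat n) * (of_real t ^ Suc n * ?w t))"
  have "continuous_on {0..1} h"
    unfolding h_def using p q by (intro continuous_intros continuous_on_powr_complex) auto
  moreover have "(h has_vector_derivative h' t) (at t)" if "t \<in> {0<..<1}" for t
  proof -
    \<comment> \<open>The derivative is taken in a complex variable, where \<open>powr\<close> is
      holomorphic off the nonpositive reals, and then restricted to the open interval; at the
      endpoints continuity of \<open>h\<close> suffices.\<close>
    have *: "((\<lambda>z. z ^ n * (z powr p * (1 - z) powr q)) has_field_derivative h' t) (at (of_real t))"
    proof -
      have nz: "complex_of_real t \<noteq> 0" "1 - complex_of_real t \<noteq> 0"
        using that by (auto simp: complex_eq_iff)
      have nr: "complex_of_real t \<notin> \<real>\<^sub>\<le>\<^sub>0" "1 - complex_of_real t \<notin> \<real>\<^sub>\<le>\<^sub>0"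
        using that by (auto simp: complex_nonpos_Reals_iff)
      have e: "complex_of_real t powr p = of_real t * of_real t powr (p - 1)"
        "(1 - complex_of_real t) powr q = (1 - of_real t) * (1 - of_real t) powr (q - 1)"
        using nz by (simp_all add: powr_diff)
      show ?thesis
        apply (rule derivative_eq_intros refl nr | use nr in simp; fail)+
        unfolding h'_def beta_weight_def
        by (cases n) (simp_all add: e algebra_simps)
    qed
    have "h = (\<lambda>t. (\<lambda>z. z ^ n * (z powr p * (1 - z) powr q)) (of_real t))"
      by (simp add: h_def)
    with has_vector_derivative_real_field[OF *] show ?thesis by simp
  qed
  ultimately have "(h' has_integral (h 1 - h 0)) {0..1}"
    by (intro fundamental_theorem_of_calculus_interior) auto
  moreover have "h 1 = 0" "h 0 = 0" by (auto simp: h_def)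
  ultimately have "integral {0..1} h' = 0" by (simp add: integral_unique)
  moreover have "(\<lambda>t. of_real t ^ k * ?w t) integrable_on {0..1}" for k
    by (intro integrable_continuous_real continuous_intros continuous_on_beta_weight p q)
  ultimately show ?thesis
    unfolding h'_def by (subst (asm) integral_diff) (simp_all add: integrable_on_mult_right del: power_Suc)
qed

text \<open>Iterating \<open>beta_moment_rec\<close> collects one factor (p+n)/(p+q+n) at a time.
  This is how Pochhammer quotients become Euler integrals below.\<close>

lemma beta_moment:
  assumes p: "Re p > 1" and q: "Re q > 1"
  shows "integral {0..1} (\<lambda>t. of_real t ^ n * beta_weight p q t) =
         integral {0..1} (beta_weight p q) * pochhammer p n / pochhammer (p + q) n"
proof (induction n)
  case (Suc n)
  have "Re (p + q + of_nat n) \<noteq> 0" using p q by simp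
  then have "p + q + of_nat n \<noteq> 0" by force
  then have "integral {0..1} (\<lambda>t. of_real t ^ Suc n * beta_weight p q t) =
      (p + of_nat n) * integral {0..1} (\<lambda>t. of_real t ^ n * beta_weight p q t) / (p + q + of_nat n)"
    using beta_moment_rec[OF p q, of n] by (simp add: eq_divide_eq mult.commute del: power_Suc)
  then show ?case
    unfolding Suc.IH by (simp add: pochhammer_rec' mult_ac del: power_Suc)
qed auto

text \<open>If the integral vanished, then so would all moments of the weight.\<close>

lemma beta_integral_nonzero:
  assumes p: "Re p > 1" and q: "Re q > 1"
  shows "integral {0..1} (beta_weight p q) \<noteq> 0"
proof
  let ?w = "beta_weight p q"
  assume "integral {0..1} ?w = 0"
  then have mom: "integral {0..1} (\<lambda>t. of_real t ^ n * ?w t) = 0" for n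
    by (simp add: beta_moment[OF p q])
  have int: "(\<lambda>t. of_real t ^ n * ?w t) integrable_on {0..1}" for n
    by (intro integrable_continuous_real continuous_intros continuous_on_beta_weight p q)
  have part: "integral {0..1} (\<lambda>t. t ^ n * h (?w t)) = 0"
    if "bounded_linear h" "\<And>r z. h (of_real r * z) = r * h z" for h :: "complex \<Rightarrow> real" and n
    using integral_linear[OF int that(1), of n] that(2)[of "_ ^ _"] mom
    by (simp add: o_def linear_0 bounded_linear.linear[OF that(1)])
  \<comment> \<open>The moment lemma is about real functions, so real and imaginary parts are
    treated separately. At 1/2 both powers have a nonzero base, so the weight cannot vanish
    there.\<close>
  have "Re (?w (1/2)) = 0"
    by (rule continuous_vanishing_moments)
      (auto intro!: continuous_intros continuous_on_beta_weight p q part bounded_linear_Re)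
  moreover have "Im (?w (1/2)) = 0"
    by (rule continuous_vanishing_moments)
      (auto intro!: continuous_intros continuous_on_beta_weight p q part bounded_linear_Im)
  ultimately have "?w (1/2) = 0" by (simp add: complex_eq_iff)
  then show False by (simp add: beta_weight_def)
qed

section \<open>Geometry of the slit plane\<close>

lemma open_hypergeo_slit_plane: "open hypergeo_slit_plane"
proof -
  have "closed (complex_of_real ` {1..})"
    by (intro closed_injective_linear_image) (auto intro: linear_of_real inj_of_real)
  then show ?thesis by (simp add: open_Compl)
qed

text \<open>The condition on \<open>1 - z\<close> is the one under which principal powers of
  \<open>1 - z\<close> are holomorphic.\<close>

lemma hypergeo_slit_plane_iff: "z \<in> hypergeo_slit_plane \<longleftrightarrow> 1 - z \<notin> \<real>\<^sub>\<le>\<^sub>0"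
proof -
  have "z \<in> complex_of_real ` {1..} \<longleftrightarrow> 1 - z \<in> \<real>\<^sub>\<le>\<^sub>0"
    by (auto simp: image_iff complex_nonpos_Reals_iff complex_eq_iff intro!: bexI[of _ "Re z"])
  then show ?thesis by simp
qed

lemma ball_subset_hypergeo_slit_plane: "ball 0 1 \<subseteq> hypergeo_slit_plane"
  by (auto simp: image_iff)

text \<open>Star-shapedness about 0 ensures that an Euler integral over f(tz) evaluates f only
  inside the slit plane.\<close>

lemma hypergeo_slit_plane_mult_real:
  assumes z: "z \<in> hypergeo_slit_plane" and t: "t \<in> {0..1}"
  shows "of_real t * z \<in> hypergeo_slit_plane"
proof
  assume "of_real t * z \<in> complex_of_real ` {1..}"
  then obtain r where r: "r \<ge> 1" "of_real t * z = of_real r" by auto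
  then have "t > 0" using t by (cases "t = 0") auto
  then have "z = of_real (r / t)" using r by (simp add: field_simps)
  moreover have "r / t \<ge> 1" using r t \<open>t > 0\<close> by (simp add: field_simps)
  ultimately show False using z by blast
qed

section \<open>Power series that continue to the slit plane\<close>

text \<open>Only the germ at 0 is tied to the coefficients, so closure properties reduce to matching
  operations on holomorphic functions and on formal power series.\<close>

definition continuable :: "(nat \<Rightarrow> complex) \<Rightarrow> bool" where
  "continuable v \<longleftrightarrow> (\<exists>f. f holomorphic_on hypergeo_slit_plane \<and> f has_fps_expansion Abs_fps v)"

text \<open>A Taylor series at 0 converges on every disc about 0 on which the function is
  holomorphic, and the unit disc lies in the slit plane. Convergence is thus obtained without
  estimating coefficients.\<close>

lemma continuableE:
  assumes "continuable v"
  obtains f where "f holomorphic_on hypergeo_slit_plane" "f has_fps_expansion Abs_fps v"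
    "\<And>z. norm z < 1 \<Longrightarrow> (\<lambda>n. v n * z ^ n) sums f z"
proof -
  obtain f where f: "f holomorphic_on hypergeo_slit_plane" "f has_fps_expansion Abs_fps v"
    using assms by (auto simp: continuable_def)
  have "f holomorphic_on eball 0 1"
    using f(1) ball_subset_hypergeo_slit_plane by (auto simp: one_ereal_def intro: holomorphic_on_subset)
  from has_fps_expansion_imp_sums_complex[OF f(2) this] f that show ?thesis
    by (auto simp: one_ereal_def)
qed

lemma binomial_has_fps_expansion:
  fixes \<gamma> :: complex
  shows   "(\<lambda>z. (1 - z) powr (-\<gamma>)) has_fps_expansion Abs_fps (\<lambda>n. pochhammer \<gamma> n / fact n)"
proof (rule has_fps_expansionI)
  have "(\<lambda>n. (pochhammer \<gamma> n / fact n) * z ^ n) sums (1 - z) powr (-\<gamma>)" if "norm z < 1" for z :: complex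
    using gen_binomial_complex[of "-z" "-\<gamma>"] that
    by (simp add: gbinomial_pochhammer power_minus[of z] mult_ac)
  then show "\<forall>\<^sub>F u in nhds 0. (\<lambda>n. fps_nth (Abs_fps (\<lambda>n. pochhammer \<gamma> n / fact n)) n * u ^ n)
      sums (1 - u) powr (-\<gamma>)"
    by (intro eventually_mono[OF eventually_nhds_in_open[of "ball 0 1"]]) auto
qed

lemma continuable_binomial: "continuable (\<lambda>n. pochhammer \<gamma> n / fact n)"
  unfolding continuable_def
proof (intro exI conjI)
  show "(\<lambda>z. (1 - z) powr (-\<gamma>)) holomorphic_on hypergeo_slit_plane"
    by (intro holomorphic_intros) (use hypergeo_slit_plane_iff in blast)
qed (rule binomial_has_fps_expansion)

lemma continuable_cmult: "continuable v \<Longrightarrow> continuable (\<lambda>n. c * v n)"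
  unfolding continuable_def
proof (elim exE conjE, intro exI conjI)
  fix f assume f: "f holomorphic_on hypergeo_slit_plane" "f has_fps_expansion Abs_fps v"
  show "(\<lambda>z. c * f z) holomorphic_on hypergeo_slit_plane"
    by (intro holomorphic_intros f)
  show "(\<lambda>z. c * f z) has_fps_expansion Abs_fps (\<lambda>n. c * v n)"
    using has_fps_expansion_cmult_left[OF f(2), of c] by (simp add: fps_const_mult_left)
qed

text \<open>The operator c + z d/dz multiplies the n-th coefficient by c + n.\<close>

lemma continuable_mult_linear: "continuable v \<Longrightarrow> continuable (\<lambda>n. (c + of_nat n) * v n)"
  unfolding continuable_def
proof (elim exE conjE, intro exI conjI)
  fix f assume f: "f holomorphic_on hypergeo_slit_plane" "f has_fps_expansion Abs_fps v"
  show "(\<lambda>z. c * f z + z * deriv f z) holomorphic_on hypergeo_slit_plane"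
    by (intro holomorphic_intros f open_hypergeo_slit_plane)
  have "(\<lambda>z. c * f z + z * deriv f z) has_fps_expansion
      fps_const c * Abs_fps v + fps_X * fps_deriv (Abs_fps v)"
    by (intro fps_expansion_intros f)
  also have "fps_const c * Abs_fps v + fps_X * fps_deriv (Abs_fps v) =
      Abs_fps (\<lambda>n. (c + of_nat n) * v n)"
    by (rule fps_ext) (auto simp: algebra_simps)
  finally show "(\<lambda>z. c * f z + z * deriv f z) has_fps_expansion \<dots>" .
qed

lemma continuable_unshift: "continuable (\<lambda>n. v (Suc n)) \<Longrightarrow> continuable v"
  unfolding continuable_def
proof (elim exE conjE, intro exI conjI)
  fix f assume f: "f holomorphic_on hypergeo_slit_plane"
    "f has_fps_expansion Abs_fps (\<lambda>n. v (Suc n))"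
  show "(\<lambda>z. v 0 + z * f z) holomorphic_on hypergeo_slit_plane"
    by (intro holomorphic_intros f)
  have "(\<lambda>z. v 0 + z * f z) has_fps_expansion
      fps_const (v 0) + fps_X * Abs_fps (\<lambda>n. v (Suc n))"
    by (intro fps_expansion_intros f)
  also have "fps_const (v 0) + fps_X * Abs_fps (\<lambda>n. v (Suc n)) = Abs_fps v"
    by (rule fps_ext) (auto simp: fps_nth_Abs_fps)
  finally show "(\<lambda>z. v 0 + z * f z) has_fps_expansion \<dots>" .
qed

text \<open>The quotient (f(z) - f(0))/z has a removable singularity at 0, filled by the
  derivative.\<close>

lemma continuable_shift: "continuable v \<Longrightarrow> continuable (\<lambda>n. v (Suc n))"
  unfolding continuable_def
proof (elim exE conjE, intro exI conjI)
  fix f assume f: "f holomorphic_on hypergeo_slit_plane" "f has_fps_expansion Abs_fps v"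
  let ?g = "\<lambda>z. if z = 0 then deriv f 0 else (f z - f 0) / (z - 0)"
  show "?g holomorphic_on hypergeo_slit_plane"
    by (rule pole_lemma_open[OF f(1) open_hypergeo_slit_plane])
  have f0: "f 0 = v 0"
    using has_fps_expansion_imp_0_eq_fps_nth_0[OF f(2)] by simp
  have "deriv f 0 = v 1"
    using has_fps_expansion_imp_0_eq_fps_nth_0[OF has_fps_expansion_deriv[OF f(2)]] by simp
  moreover have "Abs_fps v = fps_const (v 0) + fps_X * Abs_fps (\<lambda>n. v (Suc n))"
    by (rule fps_ext) auto
  ultimately have *: "(\<lambda>z. f z - f 0) has_fps_expansion fps_X * Abs_fps (\<lambda>n. v (Suc n))"
    using has_fps_expansion_diff[OF f(2) has_fps_expansion_const[of "v 0"]] f0 by simp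
  \<comment> \<open>Shifting requires subdegree at least 1. The zero series has subdegree 0 by
    convention and needs its own case.\<close>
  show "?g has_fps_expansion Abs_fps (\<lambda>n. v (Suc n))"
  proof (cases "fps_X * Abs_fps (\<lambda>n. v (Suc n)) = 0")
    case False
    then have "1 \<le> subdegree (fps_X * Abs_fps (\<lambda>n. v (Suc n)))"
      by (intro subdegree_geI) auto
    from has_fps_expansion_shift[OF * this, of "deriv f 0"] \<open>deriv f 0 = v 1\<close>
    have "(\<lambda>z. if z = 0 then deriv f 0 else (f z - f 0) / z ^ 1) has_fps_expansion
        fps_shift 1 (fps_X * Abs_fps (\<lambda>n. v (Suc n)))"
      by simp
    also have "fps_shift 1 (fps_X * Abs_fps (\<lambda>n. v (Suc n))) = Abs_fps (\<lambda>n. v (Suc n))"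
      by (rule fps_ext) simp
    finally show ?thesis
      by (simp only: power_one_right diff_zero)
  next
    case True
    then have "Abs_fps (\<lambda>n. v (Suc n)) = 0" by simp
    moreover have "v 1 = 0" using arg_cong[OF calculation, of "\<lambda>F. fps_nth F 0"] by simp
    ultimately show ?thesis
      using * \<open>deriv f 0 = v 1\<close> unfolding has_fps_expansion_0_iff
      by (auto elim: eventually_mono simp: has_fps_expansion_0_iff)
  qed
qed

section \<open>Euler integrals acting on coefficients\<close>

text \<open>The continuation is the integral of w(t) f(tz) over [0,1], divided by the integral of w.
  It is holomorphic by differentiation under the integral sign, and termwise integration on the disc
  produces the moments of the weight.\<close>

lemma continuable_beta_integral:
  assumes v: "continuable v" and p: "Re p > 1" and q: "Re q > 1"
  shows "continuable (\<lambda>n. pochhammer p n / pochhammer (p + q) n * v n)"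
proof -
  let ?w = "beta_weight p q"
  define M where "M = integral {0..1} ?w"
  have M: "M \<noteq> 0" unfolding M_def by (rule beta_integral_nonzero[OF p q])
  note w = continuous_on_beta_weight[OF p q]
  obtain f where f: "f holomorphic_on hypergeo_slit_plane"
    "f has_fps_expansion Abs_fps v"
    "\<And>z. norm z < 1 \<Longrightarrow> (\<lambda>n. v n * z ^ n) sums f z"
    by (rule continuableE[OF v]) (rule that; simp)
  have cf: "continuous_on hypergeo_slit_plane f" "continuous_on hypergeo_slit_plane (deriv f)"
    by (intro holomorphic_on_imp_continuous_on holomorphic_deriv f(1) open_hypergeo_slit_plane)+
  define g where "g z = integral (cbox 0 1) (\<lambda>t. ?w t * f (of_real t * z))" for z
  have ce: "continuous_on {0..1} (\<lambda>t. ?w t * f (of_real t * z))" if "z \<in> hypergeo_slit_plane" for z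
    using that
    by (intro continuous_intros w continuous_on_compose2[OF cf(1)] image_subsetI hypergeo_slit_plane_mult_real)
  have "g field_differentiable at z" if z: "z \<in> hypergeo_slit_plane" for z
  proof -
    \<comment> \<open>The Leibniz rule asks for a convex domain, which the slit plane is not; hence
      the small balls.\<close>
    obtain e where e: "e > 0" "ball z e \<subseteq> hypergeo_slit_plane"
      using open_hypergeo_slit_plane z by (meson openE)
    have "g holomorphic_on ball z e"
      unfolding g_def
    proof (rule leibniz_rule_holomorphic)
      fix x t assume x: "x \<in> ball z e" and t: "t \<in> cbox 0 (1::real)"
      have "of_real t * x \<in> hypergeo_slit_plane"
        using x e t by (intro hypergeo_slit_plane_mult_real) auto
      then have "(f has_field_derivative deriv f (of_real t * x)) (at (of_real t * x))"
        by (intro holomorphic_derivI[OF f(1) open_hypergeo_slit_plane])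
      then have "((\<lambda>x. f (of_real t * x)) has_field_derivative of_real t * deriv f (of_real t * x)) (at x)"
        using DERIV_chain2[OF _ DERIV_cmult_Id] by (metis mult.commute)
      then show "((\<lambda>x. ?w t * f (of_real t * x)) has_field_derivative
          ?w t * (of_real t * deriv f (of_real t * x))) (at x within ball z e)"
        by (intro DERIV_cmult) (rule has_field_derivative_at_within)
    next
      fix x assume "x \<in> ball z e"
      then show "(\<lambda>t. ?w t * f (of_real t * x)) integrable_on cbox 0 1"
        unfolding cbox_interval using e(2) by (intro integrable_continuous_real ce) blast
    next
      have "of_real (snd xt) * fst xt \<in> hypergeo_slit_plane" if "xt \<in> ball z e \<times> cbox 0 1" for xt
        using e(2) that by (intro hypergeo_slit_plane_mult_real) auto
      then show "continuous_on (ball z e \<times> cbox 0 1) (\<lambda>(x, t). ?w t * (of_real t * deriv f (of_real t * x)))"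
        unfolding case_prod_beta
        by (intro continuous_intros continuous_on_compose2[OF w] continuous_on_compose2[OF cf(2)] image_subsetI) auto
    qed auto
    then show ?thesis using e
      by (simp add: holomorphic_on_imp_differentiable_at)
  qed
  then have "g holomorphic_on hypergeo_slit_plane"
    by (auto simp: holomorphic_on_def field_differentiable_at_within)
  then have hol: "(\<lambda>z. g z / M) holomorphic_on hypergeo_slit_plane"
    by (intro holomorphic_intros M)
  obtain B where B: "\<And>t. t \<in> {0..1} \<Longrightarrow> norm (?w t) \<le> B" "B > 0"
    using compact_imp_bounded[OF compact_continuous_image[OF w compact_Icc]]
    unfolding bounded_pos by (metis imageI)
  have sums: "(\<lambda>n. pochhammer p n / pochhammer (p + q) n * v n * z ^ n) sums (g z / M)"
    if z: "norm z < 1" for z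
  proof -
    \<comment> \<open>The series converges at radius \<open>(1 + norm z) / 2\<close>, strictly
      between \<open>norm z\<close> and 1, hence absolutely at \<open>z\<close>. This majorises it
      at all \<open>t * z\<close> and gives uniform convergence in \<open>t\<close>.\<close>
    have "summable (\<lambda>n. norm (v n * z ^ n))"
    proof (rule powser_insidea)
      show "norm z < norm (complex_of_real ((1 + norm z) / 2))"
        using z by (simp del: of_real_divide of_real_add)
      show "summable (\<lambda>n. v n * complex_of_real ((1 + norm z) / 2) ^ n)"
        by (rule sums_summable[OF f(3)]) (use z in \<open>simp del: of_real_divide of_real_add\<close>)
    qed
    then have "uniform_limit {0..1} (\<lambda>n t. \<Sum>i<n. ?w t * (v i * (of_real t * z) ^ i))
        (\<lambda>t. \<Sum>i. ?w t * (v i * (of_real t * z) ^ i)) sequentially"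
    proof (intro Weierstrass_m_test)
      fix n and t :: real assume t: "t \<in> {0..1}"
      have "norm (?w t * (v n * (of_real t * z) ^ n)) = norm (?w t) * (norm (v n * z ^ n) * t ^ n)"
        using t by (simp add: norm_mult norm_power power_mult_distrib mult_ac)
      also have "\<dots> \<le> B * (norm (v n * z ^ n) * 1)"
        using t B by (intro mult_mono power_le_one) auto
      finally show "norm (?w t * (v n * (of_real t * z) ^ n)) \<le> B * norm (v n * z ^ n)"
        by simp
    qed (intro summable_mult)
    also have "?this \<longleftrightarrow> uniform_limit {0..1} (\<lambda>n t. \<Sum>i<n. ?w t * (v i * (of_real t * z) ^ i))
        (\<lambda>t. ?w t * f (of_real t * z)) sequentially"
    proof (intro uniform_limit_cong' refl)
      fix t :: real assume t: "t \<in> {0..1}"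
      have "norm (of_real t * z) \<le> 1 * norm z"
        unfolding norm_mult using t by (intro mult_right_mono) auto
      then have "(\<lambda>n. v n * (of_real t * z) ^ n) sums f (of_real t * z)"
        using z by (intro f(3)) auto
      from sums_mult[OF this, of "?w t"] show "(\<Sum>i. ?w t * (v i * (of_real t * z) ^ i)) = ?w t * f (of_real t * z)"
        by (simp add: sums_iff)
    qed
    finally obtain I J where IJ: "\<And>n. ((\<lambda>t. \<Sum>i<n. ?w t * (v i * (of_real t * z) ^ i)) has_integral I n) {0..1}"
      "((\<lambda>t. ?w t * f (of_real t * z)) has_integral J) {0..1}" "I \<longlonglongrightarrow> J"
      by (rule uniform_limit_integral) (auto intro!: continuous_intros w)
    have "I n = (\<Sum>i<n. M * (pochhammer p i / pochhammer (p + q) i * v i * z ^ i))" for n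
    proof -
      have "I n = integral {0..1} (\<lambda>t. \<Sum>i<n. ?w t * (v i * (of_real t * z) ^ i))"
        by (rule integral_unique[OF IJ(1), symmetric])
      also have "\<dots> = (\<Sum>i<n. integral {0..1} (\<lambda>t. ?w t * (v i * (of_real t * z) ^ i)))"
        by (intro integral_sum integrable_continuous_real continuous_intros w) auto
      also have "\<dots> = (\<Sum>i<n. (v i * z ^ i) * integral {0..1} (\<lambda>t. of_real t ^ i * ?w t))"
        by (simp add: power_mult_distrib mult_ac flip: integral_mult_right)
      finally show ?thesis by (simp add: beta_moment[OF p q] M_def mult_ac)
    qed
    then have "I = (\<lambda>n. \<Sum>i<n. M * (pochhammer p i / pochhammer (p + q) i * v i * z ^ i))"
      by blast
    moreover have "J = g z" using IJ(2) by (simp add: g_def integral_unique)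
    ultimately have "(\<lambda>n. M * (pochhammer p n / pochhammer (p + q) n * v n * z ^ n)) sums g z"
      using IJ(3) unfolding sums_def by (simp only:)
    from sums_divide[OF this, of M] M show ?thesis by simp
  qed
  show ?thesis
    unfolding continuable_def
  proof (intro exI conjI)
    show "(\<lambda>z. g z / M) has_fps_expansion Abs_fps (\<lambda>n. pochhammer p n / pochhammer (p + q) n * v n)"
      by (intro has_fps_expansionI eventually_mono[OF eventually_nhds_in_open[of "ball 0 1"]])
        (auto simp: sums simp del: times_divide_eq_left)
  qed (rule hol)
qed

text \<open>Removing the constant coefficient and multiplying the coefficients by linear polynomials raises
  the parameters until the weight of the Euler integral is continuous on $[0,1]$.\<close>

lemma continuable_pochhammer_ratio:
  assumes v: "continuable v" and p: "Re p > 0" and q: "Re q > Re p"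
  shows "continuable (\<lambda>n. pochhammer p n / pochhammer q n * v n)"
proof -
  have nz: "q + of_nat n \<noteq> 0" for n
  proof -
    have "Re (q + of_nat n) > 0" using p q by simp
    then show ?thesis by force
  qed
  \<comment> \<open>Raising both weight exponents by 1 turns (p)_n/(q)_n into (p+1)_n/(q+2)_n. The
    surplus is corrected through (p)_(n+1) = p (p+1)_n and q (q+1) (q+2)_n = (q+1+n)
    (q)_(n+1).\<close>
  have e: "(p + 1) + (q - p + 1) = q + 2" by simp
  have "continuable (\<lambda>n. p / (q * (q + 1)) * ((q + 1 + of_nat n) * (pochhammer (p + 1) n / pochhammer (q + 2) n * v (Suc n))))"
    using continuable_beta_integral[OF continuable_shift[OF v], of "p + 1" "q - p + 1"] p q
    unfolding e by (intro continuable_cmult continuable_mult_linear) auto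
  also have "(\<lambda>n. p / (q * (q + 1)) * ((q + 1 + of_nat n) * (pochhammer (p + 1) n / pochhammer (q + 2) n * v (Suc n)))) =
     (\<lambda>n. pochhammer p (Suc n) / pochhammer q (Suc n) * v (Suc n))"
  proof
    fix n
    have "pochhammer q (Suc (Suc n)) = q * (q + 1) * pochhammer (q + 2) n"
      by (simp only: pochhammer_rec) (simp add: add.assoc)
    moreover have "pochhammer q (Suc (Suc n)) = (q + 1 + of_nat n) * pochhammer q (Suc n)"
      by (simp only: pochhammer_rec'[of q "Suc n"]) (simp add: add_ac)
    ultimately have "(q + 1 + of_nat n) * pochhammer q (Suc n) = q * (q + 1) * pochhammer (q + 2) n"
      by simp
    moreover have "q + 1 + of_nat n \<noteq> 0" "q \<noteq> 0" "q + 1 \<noteq> 0"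
      using nz[of "Suc n"] nz[of 0] nz[of 1] by (simp_all add: add_ac)
    ultimately have "(q + 1 + of_nat n) / (q * (q + 1) * pochhammer (q + 2) n) = 1 / pochhammer q (Suc n)"
      by (metis (no_types, lifting) mult.right_neutral nonzero_mult_divide_mult_cancel_left)
    moreover have "p / (q * (q + 1)) * ((q + 1 + of_nat n) * (pochhammer (p + 1) n / pochhammer (q + 2) n * v (Suc n)))
       = (q + 1 + of_nat n) / (q * (q + 1) * pochhammer (q + 2) n) * (p * pochhammer (p + 1) n * v (Suc n))"
      by simp
    ultimately show "p / (q * (q + 1)) * ((q + 1 + of_nat n) * (pochhammer (p + 1) n / pochhammer (q + 2) n * v (Suc n)))
       = pochhammer p (Suc n) / pochhammer q (Suc n) * v (Suc n)"
      by (simp add: pochhammer_rec[of p] del: pochhammer_Suc)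
  qed
  finally show ?thesis by (rule continuable_unshift)
qed

section \<open>Rearranging an absolutely convergent double series\<close>

text \<open>The product majorant makes the family absolutely summable over all pairs, so rows and
  diagonals have the same total.\<close>

lemma sums_regroup_diagonals:
  fixes A :: "nat \<Rightarrow> nat \<Rightarrow> 'a :: banach" and X Y :: "nat \<Rightarrow> real"
  assumes X: "summable X" "\<And>k. X k \<ge> 0" and Y: "summable Y" "\<And>j. Y j \<ge> 0"
    and A: "\<And>k j. norm (A k j) \<le> X k * Y j"
    and diag: "(\<lambda>n. \<Sum>k\<le>n. A k (n - k)) sums S"
  shows "(\<lambda>k. \<Sum>j. A k j) sums S"
proof -
  have sX: "X summable_on UNIV"
    by (rule norm_summable_imp_summable_on) (simp add: X)
  have sY: "(Y has_sum suminf Y) UNIV"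
    by (rule sums_nonneg_imp_has_sum[OF summable_sums]) (rule Y)+
  have "(\<lambda>p. X (fst p) * Y (snd p)) summable_on UNIV \<times> UNIV"
  proof (rule summable_on_SigmaI)
    show "((\<lambda>j. X (fst (k, j)) * Y (snd (k, j))) has_sum X k * suminf Y) UNIV" for k
      unfolding fst_conv snd_conv by (rule has_sum_cmult_right[OF sY])
    show "(\<lambda>k. X k * suminf Y) summable_on UNIV"
      by (rule summable_on_cmult_left[OF sX])
  qed (simp add: X Y)
  then have "(\<lambda>p. norm (A (fst p) (snd p))) summable_on UNIV \<times> UNIV"
    by (rule summable_on_comparison_test) (auto simp: A)
  from abs_summable_summable[OF this]
  obtain T where T: "((\<lambda>p. A (fst p) (snd p)) has_sum T) (UNIV \<times> UNIV)"
    unfolding summable_on_def by (elim exE)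
  have "(A k has_sum (\<Sum>j. A k j)) UNIV" for k
  proof -
    have "summable (\<lambda>j. norm (A k j))"
      by (rule summable_comparison_test'[OF summable_mult[OF Y(1), of "X k"], of 0]) (simp add: A)
    from norm_summable_imp_has_sum[OF this summable_sums[OF summable_norm_cancel[OF this]]]
    show ?thesis .
  qed
  then have "((\<lambda>k. \<Sum>j. A k j) has_sum T) UNIV"
    by (intro has_sum_SigmaD[OF T]) simp
  then have rows: "(\<lambda>k. \<Sum>j. A k j) sums T"
    by (rule has_sum_imp_sums)
  \<comment> \<open>Pairs (k, j) are reindexed as (n, k) with n = k + j and k at most n.\<close>
  have "((\<lambda>p. A (snd p) (fst p - snd p)) has_sum T) (Sigma UNIV (\<lambda>n. {..n}))"
    using T by (subst has_sum_reindex_bij_witness[where i = "\<lambda>(k, j). (k + j, k)" and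
          j = "\<lambda>(n, k). (k, n - k)" and T = "UNIV \<times> UNIV" and h = "\<lambda>p. A (fst p) (snd p)" and s' = T]) auto
  from has_sum_SigmaD[OF this, of "\<lambda>n. \<Sum>k\<le>n. A k (n - k)"]
  have "(\<lambda>n. \<Sum>k\<le>n. A k (n - k)) sums T"
    by (intro has_sum_imp_sums) auto
  with diag have "S = T" by (rule sums_unique2)
  with rows show ?thesis by simp
qed

section \<open>The substitution s/(s-1) in power series\<close>

lemma pochhammer_minus_of_nat:
  assumes "m \<le> n"
  shows "pochhammer (- of_nat n :: 'a :: field_char_0) m = (-1) ^ m * fact n / fact (n - m)"
proof -
  have "pochhammer (- of_nat n :: 'a) n = pochhammer (- of_nat n) m * pochhammer (- of_nat (n - m)) (n - m)"
    using pochhammer_product[OF assms, of "- of_nat n :: 'a"] assms by (simp add: of_nat_diff)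
  then have "(-1) ^ n * fact n = pochhammer (- of_nat n :: 'a) m * ((-1) ^ (n - m) * fact (n - m))"
    by (simp add: pochhammer_same)
  moreover have "(-1) ^ n = (-1) ^ m * (-1 :: 'a) ^ (n - m)"
    using assms by (simp flip: power_add)
  ultimately show ?thesis
    by (simp add: field_simps)
qed

text \<open>One has 1 - s/(s-1) = 1/(1-s), where 1-s has positive real part.\<close>

lemma euler_map_mem_slit_plane:
  assumes "norm s < 1"
  shows "s / (s - 1) \<in> hypergeo_slit_plane"
proof -
  have "Re s < 1" using assms complex_Re_le_cmod[of s] by linarith
  then have "1 - s \<notin> \<real>\<^sub>\<le>\<^sub>0" "s \<noteq> 1" by (auto simp: complex_nonpos_Reals_iff)
  moreover have "1 - s / (s - 1) = inverse (1 - s)"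
    using \<open>s \<noteq> 1\<close> by (simp add: field_simps)
  ultimately show ?thesis
    by (simp only: hypergeo_slit_plane_iff nonpos_Reals_inverse_iff) simp
qed

text \<open>The substitution \<open>s \<mapsto> s / (s - 1)\<close> maps the disc into the slit plane, so the transformed series
  converges on the whole disc although the coefficients are alternating sums with large terms.\<close>

lemma euler_transform_sums:
  assumes f: "f holomorphic_on hypergeo_slit_plane"
    and F: "f has_fps_expansion Abs_fps (\<lambda>n. pochhammer \<gamma> n / fact n * v n)"
    and s: "norm s < 1"
  shows "(\<lambda>n. pochhammer \<gamma> n / fact n *
            (\<Sum>m\<le>n. pochhammer (- of_nat n) m / fact m * v m) * s ^ n)
         sums ((1 - s) powr (-\<gamma>) * f (s / (s - 1)))"
proof -
  let ?F = "Abs_fps (\<lambda>n. pochhammer \<gamma> n / fact n * v n)"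
  let ?B = "\<lambda>\<gamma>. Abs_fps (\<lambda>n. pochhammer \<gamma> n / fact n) :: complex fps"
  define G where "G = fps_X / (fps_X - 1 :: complex fps)"
  have G: "(\<lambda>s. s / (s - 1)) has_fps_expansion G"
    unfolding G_def by (intro fps_expansion_intros) auto
  have G0: "fps_nth G 0 = 0"
    using has_fps_expansion_imp_0_eq_fps_nth_0[OF G] by simp
  \<comment> \<open>Coefficient form of (s/(s-1))^m (1-s)^(-\<gamma>) = (-1)^m s^m
    (1-s)^(-\<gamma>-m), transferred from functions by uniqueness of expansions.\<close>
  have GB: "G ^ m * ?B \<gamma> = fps_const ((-1) ^ m) * (fps_X ^ m * ?B (\<gamma> + of_nat m))" for m
  proof (rule fps_expansion_unique_complex)
    show "(\<lambda>s. (s / (s - 1)) ^ m * (1 - s) powr (-\<gamma>)) has_fps_expansion G ^ m * ?B \<gamma>"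
      by (intro fps_expansion_intros G binomial_has_fps_expansion)
    have "\<forall>\<^sub>F s in nhds (0::complex). s \<in> ball 0 1"
      by (intro eventually_nhds_in_open) auto
    then have ev: "\<forall>\<^sub>F s in nhds (0::complex). (-1) ^ m * (s ^ m * (1 - s) powr (-(\<gamma> + of_nat m))) =
        (s / (s - 1)) ^ m * (1 - s) powr (-\<gamma>)"
    proof eventually_elim
      case (elim s)
      then have s: "1 - s \<noteq> 0" by auto
      have "(1 - s) powr (-(\<gamma> + of_nat m)) = (1 - s) powr (-\<gamma>) / (1 - s) ^ m"
        using s powr_diff[of "1 - s" "-\<gamma>" "of_nat m"] by (simp add: powr_nat')
      moreover have "s / (s - 1) = (-1) * s / (1 - s)"
        using s by (simp add: field_simps)
      ultimately show ?case
        by (simp only: power_divide power_mult_distrib) simp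
    qed
    have ex: "(\<lambda>s. (-1) ^ m * (s ^ m * (1 - s) powr (-(\<gamma> + of_nat m)))) has_fps_expansion
        fps_const ((-1) ^ m) * (fps_X ^ m * ?B (\<gamma> + of_nat m))"
      by (intro fps_expansion_intros binomial_has_fps_expansion)
    show "(\<lambda>s. (s / (s - 1)) ^ m * (1 - s) powr (-\<gamma>)) has_fps_expansion
        fps_const ((-1) ^ m) * (fps_X ^ m * ?B (\<gamma> + of_nat m))"
      by (rule iffD1[OF has_fps_expansion_cong[OF ev refl] ex])
  qed
  have coeff: "fps_nth ((?F oo G) * ?B \<gamma>) n =
      pochhammer \<gamma> n / fact n * (\<Sum>m\<le>n. pochhammer (- of_nat n) m / fact m * v m)" for n
  proof -
    \<comment> \<open>As \<open>G\<close> has no constant term, \<open>G ^ m\<close> contributes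
      nothing below degree \<open>m\<close>. All inner sums can therefore run up to
      \<open>n\<close>, and the two sums can be swapped.\<close>
    have "fps_nth (?F oo G) i = (\<Sum>m\<le>n. fps_nth ?F m * fps_nth (G ^ m) i)" if "i \<le> n" for i
      unfolding fps_compose_nth
      by (rule sum.mono_neutral_left) (use that startsby_zero_power_prefix[OF G0] in auto)
    then have "fps_nth ((?F oo G) * ?B \<gamma>) n =
        (\<Sum>i\<le>n. \<Sum>m\<le>n. fps_nth ?F m * fps_nth (G ^ m) i * fps_nth (?B \<gamma>) (n - i))"
      by (simp add: fps_mult_nth atMost_atLeast0 sum_distrib_right sum_divide_distrib)
    also have "\<dots> = (\<Sum>m\<le>n. fps_nth ?F m * fps_nth (G ^ m * ?B \<gamma>) n)"
      by (subst sum.swap) (simp add: fps_mult_nth atMost_atLeast0 sum_distrib_left mult.assoc)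
    also have "\<dots> = (\<Sum>m\<le>n. pochhammer \<gamma> n / fact n * (pochhammer (- of_nat n) m / fact m * v m))"
    proof (rule sum.cong[OF refl])
      fix m assume "m \<in> {..n}"
      then have m: "m \<le> n" by simp
      have "fps_nth (G ^ m * ?B \<gamma>) n = (-1) ^ m * (pochhammer (\<gamma> + of_nat m) (n - m) / fact (n - m))"
        unfolding GB using m by (simp add: fps_X_power_mult_nth)
      \<comment> \<open>Here (\<gamma>)_m (\<gamma>+m)_(n-m) = (\<gamma>)_n, and (-1)^m/(n-m)! =
        (-n)_m/n!.\<close>
      then show "fps_nth ?F m * fps_nth (G ^ m * ?B \<gamma>) n =
          pochhammer \<gamma> n / fact n * (pochhammer (- of_nat n) m / fact m * v m)"
        unfolding pochhammer_minus_of_nat[OF m] pochhammer_product[OF m, of \<gamma>] by (simp add: mult_ac)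
    qed
    finally show ?thesis by (simp add: sum_distrib_left)
  qed
  have "(\<lambda>s. (1 - s) powr (-\<gamma>)) holomorphic_on ball 0 1"
    using ball_subset_hypergeo_slit_plane hypergeo_slit_plane_iff
    by (intro holomorphic_intros) blast
  moreover have "(f \<circ> (\<lambda>s. s / (s - 1))) holomorphic_on ball 0 1"
  proof (rule holomorphic_on_compose_gen[OF _ f])
    show "(\<lambda>s. s / (s - 1)) holomorphic_on ball 0 1"
      by (intro holomorphic_intros) auto
    show "(\<lambda>s. s / (s - 1)) ` ball 0 1 \<subseteq> hypergeo_slit_plane"
      by (intro image_subsetI euler_map_mem_slit_plane) simp
  qed
  ultimately have "(\<lambda>s. (f \<circ> (\<lambda>s. s / (s - 1))) s * (1 - s) powr (-\<gamma>)) holomorphic_on ball 0 1"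
    by (intro holomorphic_on_mult)
  then have hol: "(\<lambda>s. (f \<circ> (\<lambda>s. s / (s - 1))) s * (1 - s) powr (-\<gamma>)) holomorphic_on eball 0 1"
    by (simp add: one_ereal_def)
  have "(\<lambda>s. (f \<circ> (\<lambda>s. s / (s - 1))) s * (1 - s) powr (-\<gamma>)) has_fps_expansion (?F oo G) * ?B \<gamma>"
    by (intro fps_expansion_intros F G G0 binomial_has_fps_expansion)
  from has_fps_expansion_imp_sums_complex[OF this hol, of s] s show ?thesis
    unfolding coeff by (simp add: one_ereal_def mult.commute[of "f _"])
qed

section \<open>Chu-Vandermonde and convergence of the series involved\<close>

text \<open>The factor (-k)_m kills the terms with k < m. For the others, (p)_k (-k)_m / ((p)_m k!)
  = (-1)^m (p+m)_(k-m)/(k-m)!, which leaves the ordinary Chu-Vandermonde sum with parameters p+m, q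
  and degree n-m.\<close>

lemma pochhammer_Vandermonde_shifted:
  fixes p q :: "'a :: field_char_0"
  assumes m: "m \<le> n" and p: "pochhammer p m \<noteq> 0" and pq: "pochhammer (p + q) m \<noteq> 0"
  shows "(\<Sum>k\<le>n. pochhammer p k / fact k * (pochhammer q (n - k) / fact (n - k)) *
            (pochhammer (- of_nat k) m / pochhammer p m)) =
         pochhammer (p + q) n / fact n * (pochhammer (- of_nat n) m / pochhammer (p + q) m)"
proof -
  have "(\<Sum>k\<le>n. pochhammer p k / fact k * (pochhammer q (n - k) / fact (n - k)) *
            (pochhammer (- of_nat k) m / pochhammer p m)) =
        (\<Sum>k=m..n. pochhammer p k / fact k * (pochhammer q (n - k) / fact (n - k)) *
            (pochhammer (- of_nat k) m / pochhammer p m))"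
    by (rule sum.mono_neutral_right) (auto simp: pochhammer_of_nat_eq_0_lemma)
  also have "\<dots> = (\<Sum>i\<le>n-m. (-1) ^ m / fact (n - m) *
      (of_nat ((n - m) choose i) * pochhammer (p + of_nat m) i * pochhammer q (n - m - i)))"
  proof (rule sum.reindex_bij_witness[of _ "\<lambda>i. i + m" "\<lambda>k. k - m"])
    fix k assume "k \<in> {m..n}"
    then have k: "m \<le> k" "k \<le> n" by auto
    then have "n - k = n - m - (k - m)" by simp
    moreover have "of_nat ((n - m) choose (k - m)) = (fact (n - m) / (fact (k - m) * fact (n - m - (k - m))) :: 'a)"
      using k by (intro binomial_fact) auto
    ultimately show "(-1) ^ m / fact (n - m) *
      (of_nat ((n - m) choose (k - m)) * pochhammer (p + of_nat m) (k - m) * pochhammer q (n - m - (k - m))) =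
      pochhammer p k / fact k * (pochhammer q (n - k) / fact (n - k)) *
            (pochhammer (- of_nat k) m / pochhammer p m)"
      unfolding pochhammer_minus_of_nat[OF k(1)] pochhammer_product[OF k(1), of p] using p by (simp add: mult_ac)
  qed (use m in auto)
  also have "\<dots> = (-1) ^ m / fact (n - m) * pochhammer (p + q + of_nat m) (n - m)"
    unfolding sum_distrib_left[symmetric] pochhammer_binomial_sum[symmetric] by (simp add: add_ac)
  also have "\<dots> = pochhammer (p + q) n / fact n * (pochhammer (- of_nat n) m / pochhammer (p + q) m)"
    unfolding pochhammer_minus_of_nat[OF m] pochhammer_product[OF m, of "p + q"] using pq by simp
  finally show ?thesis .
qed

lemma pochhammer_nonzero_Re_pos:
  assumes "Re p > 0"
  shows "pochhammer p n \<noteq> (0 :: complex)"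
  using assms by (auto simp: pochhammer_eq_0_iff)

text \<open>Two Euler integrals, one for each pair of parameters, applied to the binomial
  series.\<close>

lemma continuable_3F2:
  assumes "Re p > 0" "Re q > Re p" "Re p' > 0" "Re q' > Re p'"
  shows "continuable (\<lambda>n. pochhammer \<gamma> n / fact n *
           (pochhammer p n * pochhammer p' n / (pochhammer q n * pochhammer q' n)))"
  using continuable_pochhammer_ratio[OF continuable_pochhammer_ratio[OF continuable_binomial[of \<gamma>], of p q], of p' q'] assms
  by (simp add: mult_ac)

lemma sums_norm_in_disc:
  fixes v :: "nat \<Rightarrow> complex" and r :: real
  assumes "\<And>z. norm z < 1 \<Longrightarrow> summable (\<lambda>n. v n * z ^ n)" "0 \<le> r" "r < 1"
  shows "summable (\<lambda>n. norm (v n) * r ^ n)"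
proof -
  have "summable (\<lambda>n. norm (v n * of_real r ^ n))"
    by (rule powser_insidea[of _ "of_real ((1 + r) / 2)"])
      (use assms in \<open>auto simp del: of_real_divide of_real_add\<close>)
  then show ?thesis using assms(2) by (simp add: norm_mult norm_power)
qed

text \<open>Write the coefficient as (1)_n/(q)_n times a binomial coefficient. The ratio lemma would
  ask for Re q > 1, so it is applied with q+1, and the factor (q+n)/q restores q.\<close>

lemma summable_pochhammer_quotient:
  fixes \<gamma> q :: complex
  assumes q: "Re q > 0" and z: "norm z < 1"
  shows "summable (\<lambda>n. pochhammer \<gamma> n / pochhammer q n * z ^ n)"
proof -
  have "continuable (\<lambda>n. 1 / q * ((q + of_nat n) * (pochhammer 1 n / pochhammer (q + 1) n * (pochhammer \<gamma> n / fact n))))"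
    using q by (intro continuable_cmult continuable_mult_linear continuable_pochhammer_ratio continuable_binomial) auto
  also have "(\<lambda>n. 1 / q * ((q + of_nat n) * (pochhammer 1 n / pochhammer (q + 1) n * (pochhammer \<gamma> n / fact n)))) =
      (\<lambda>n. pochhammer \<gamma> n / pochhammer q n)"
  proof
    fix n
    have "q \<noteq> 0" using q by auto
    have "q * pochhammer (q + 1) n = (q + of_nat n) * pochhammer q n"
      using pochhammer_rec[of q n] pochhammer_rec'[of q n] by simp
    then have *: "pochhammer (q + 1) n = (q + of_nat n) * pochhammer q n / q"
      using \<open>q \<noteq> 0\<close> by (simp add: field_simps)
    have "q + of_nat n \<noteq> 0" using q by (auto simp: complex_eq_iff)
    then show "1 / q * ((q + of_nat n) * (pochhammer 1 n / pochhammer (q + 1) n * (pochhammer \<gamma> n / fact n))) =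
      pochhammer \<gamma> n / pochhammer q n"
      unfolding * using \<open>q \<noteq> 0\<close> by (simp flip: pochhammer_fact)
  qed
  finally obtain f where "\<And>z. norm z < 1 \<Longrightarrow> (\<lambda>n. pochhammer \<gamma> n / pochhammer q n * z ^ n) sums f z"
    by (rule continuableE) blast
  from this[OF z] show ?thesis by (rule sums_summable)
qed

lemma cont_dual_hahn_sum:
  "cont_dual_hahn k x a b c = pochhammer (a + b) k * pochhammer (a + c) k *
     (\<Sum>m\<le>k. pochhammer (- of_nat k) m / fact m *
       (pochhammer (a + \<i> * x) m * pochhammer (a - \<i> * x) m / (pochhammer (a + b) m * pochhammer (a + c) m)))"
proof -
  have "hypergeo [- of_nat k, a + \<i> * x, a - \<i> * x] [a + b, a + c] 1 =
      (\<Sum>n. pochhammer (- of_nat k) n / fact n * (pochhammer (a + \<i> * x) n * pochhammer (a - \<i> * x) n /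
         (pochhammer (a + b) n * pochhammer (a + c) n)))"
  proof -
    \<comment> \<open>The point 1 lies on the cut, where \<open>hypergeo\<close> is the series
      itself; this one terminates.\<close>
    have "(1 :: complex) \<notin> hypergeo_slit_plane" by (auto intro!: image_eqI[of _ _ 1])
    then show ?thesis
      unfolding hypergeo_def hypergeo_series_sum by (simp add: mult_ac)
  qed
  also have "\<dots> = (\<Sum>m\<le>k. pochhammer (- of_nat k) m / fact m *
       (pochhammer (a + \<i> * x) m * pochhammer (a - \<i> * x) m / (pochhammer (a + b) m * pochhammer (a + c) m)))"
    by (rule suminf_finite) (auto simp: pochhammer_of_nat_eq_0_lemma)
  finally show ?thesis by (simp add: cont_dual_hahn_def)
qed

section \<open>Expansion in continuous dual Hahn polynomials\<close>

theorem theorem3p6: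
  fixes \<rho> \<gamma> a b c d :: complex and x :: real
  assumes "norm \<rho> < 1" and "x > 0"
    and "Re a > 0" and "Re b > 0" and "Re c > 0" and "Re d > 0"
    and "real_or_cnj_pair a b c" and "real_or_cnj_pair a b d"
  shows "(\<lambda>k. pochhammer \<gamma> k * \<rho> ^ k /
              (pochhammer (a + b) k * pochhammer (a + c) k * fact k) *
            hypergeo [c - d, \<gamma> + of_nat k] [of_nat k + a + c] \<rho> *
            cont_dual_hahn k (of_real x) a b d)
         sums
         ((1 - \<rho>) powr (- \<gamma>) *
            hypergeo [\<gamma>, a + \<i> * of_real x, a - \<i> * of_real x] [a + b, a + c] (\<rho> / (\<rho> - 1)))"
proof -
  note rho = assms(1) and pos = assms(3-6)
  define v where "v e m = pochhammer (a + \<i> * x) m * pochhammer (a - \<i> * x) m /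
      (pochhammer (a + b) m * pochhammer (a + e) m)" for e m
  define P where "P e k = (\<Sum>m\<le>k. pochhammer (- of_nat k) m / fact m * v e m)" for e k
  have nz: "pochhammer (a + b) m \<noteq> 0" "pochhammer (a + c) m \<noteq> 0" "pochhammer (a + d) m \<noteq> 0" for m
    using pos by (auto intro!: pochhammer_nonzero_Re_pos simp del: pochhammer_eq_0_iff)

  \<comment> \<open>As \<open>x\<close> is real, both numerator parameters have real part
    \<open>Re a\<close>, strictly below those of \<open>a + b\<close> and
    \<open>a + e\<close>.\<close>
  have cont: "continuable (\<lambda>m. pochhammer \<delta> m / fact m * v e m)" if "Re e > 0" for \<delta> e
    unfolding v_def using pos that by (intro continuable_3F2) auto
  \<comment> \<open>One \<open>f\<close> carries both series: the first identifies it with the 3F2,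
    the second expands its transform.\<close>
  have transf: "\<exists>f. f holomorphic_on hypergeo_slit_plane \<and>
      (\<forall>z. norm z < 1 \<longrightarrow> (\<lambda>n. pochhammer \<delta> n / fact n * v e n * z ^ n) sums f z) \<and>
      (\<forall>s. norm s < 1 \<longrightarrow> (\<lambda>n. pochhammer \<delta> n / fact n * P e n * s ^ n) sums
        ((1 - s) powr (-\<delta>) * f (s / (s - 1))))" if e: "Re e > 0" for \<delta> e
  proof -
    obtain f where f: "f holomorphic_on hypergeo_slit_plane"
      "f has_fps_expansion Abs_fps (\<lambda>m. pochhammer \<delta> m / fact m * v e m)"
      "\<And>z. norm z < 1 \<Longrightarrow> (\<lambda>n. pochhammer \<delta> n / fact n * v e n * z ^ n) sums f z"
      by (rule continuableE[OF cont[OF e, of \<delta>]]) (rule that; simp)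
    from f(1,3) euler_transform_sums[OF f(1,2)] show ?thesis
      unfolding P_def by blast
  qed

  obtain f where f: "f holomorphic_on hypergeo_slit_plane"
    "\<And>z. norm z < 1 \<Longrightarrow> (\<lambda>n. pochhammer \<gamma> n / fact n * v c n * z ^ n) sums f z"
    "(\<lambda>n. pochhammer \<gamma> n / fact n * P c n * \<rho> ^ n) sums ((1 - \<rho>) powr (-\<gamma>) * f (\<rho> / (\<rho> - 1)))"
    using transf[OF pos(3), of \<gamma>] rho by blast
  \<comment> \<open>When Re \<rho> is at least 1/2, \<open>\<rho> / (\<rho> - 1)\<close> lies
    outside the open unit disc, so the continuation itself is needed.\<close>
  have "is_hypergeo_continuation [\<gamma>, a + \<i> * x, a - \<i> * x] [a + b, a + c] f"
    unfolding is_hypergeo_continuation_def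
  proof (intro conjI allI impI f(1))
    fix z :: complex assume "norm z < 1"
    from f(2)[OF this] show "f z = hypergeo_series [\<gamma>, a + \<i> * x, a - \<i> * x] [a + b, a + c] z"
      unfolding hypergeo_series_sum v_def by (simp add: sums_iff mult_ac)
  qed
  then have lhs: "hypergeo [\<gamma>, a + \<i> * x, a - \<i> * x] [a + b, a + c] (\<rho> / (\<rho> - 1)) = f (\<rho> / (\<rho> - 1))"
    by (intro hypergeo_eqI euler_map_mem_slit_plane rho) auto

  \<comment> \<open>The j-th term of the 2F1 in the k-th summand. Since (\<gamma>)_k (\<gamma>+k)_j
    = (\<gamma>)_(k+j), and likewise for a+c, the first factors depend on k+j only and leave the
    diagonal sums.\<close>
  define A where "A k j = pochhammer \<gamma> (k + j) / pochhammer (a + c) (k + j) * \<rho> ^ (k + j) *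
      (pochhammer (a + d) k / fact k * P d k) * (pochhammer (c - d) j / fact j)" for k j
  have diag: "(\<Sum>k\<le>n. A k (n - k)) = pochhammer \<gamma> n / fact n * P c n * \<rho> ^ n" for n
  proof -
    \<comment> \<open>The part of \<open>v e m / fact m\<close> free of \<open>e\<close>; passing
      from \<open>d\<close> to \<open>c\<close> then affects only (a+e)_m.\<close>
    define y where "y m = pochhammer (a + \<i> * x) m * pochhammer (a - \<i> * x) m / (pochhammer (a + b) m * fact m)" for m
    have P: "P e k = (\<Sum>m\<le>n. y m * (pochhammer (- of_nat k) m / pochhammer (a + e) m))" if "k \<le> n" for e k
    proof -
      have "P e k = (\<Sum>m\<le>k. y m * (pochhammer (- of_nat k) m / pochhammer (a + e) m))"
        unfolding P_def v_def y_def by (simp add: mult_ac)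
      also have "\<dots> = (\<Sum>m\<le>n. y m * (pochhammer (- of_nat k) m / pochhammer (a + e) m))"
        by (rule sum.mono_neutral_left) (use that in \<open>auto simp: pochhammer_of_nat_eq_0_lemma\<close>)
      finally show ?thesis .
    qed
    have "(\<Sum>k\<le>n. pochhammer (a + d) k / fact k * P d k * (pochhammer (c - d) (n - k) / fact (n - k))) =
        (\<Sum>k\<le>n. \<Sum>m\<le>n. y m * (pochhammer (a + d) k / fact k * (pochhammer (c - d) (n - k) / fact (n - k)) *
            (pochhammer (- of_nat k) m / pochhammer (a + d) m)))"
      by (intro sum.cong refl) (simp add: P sum_distrib_left sum_distrib_right mult_ac)
    also have "\<dots> = (\<Sum>m\<le>n. y m * (\<Sum>k\<le>n. pochhammer (a + d) k / fact k * (pochhammer (c - d) (n - k) / fact (n - k)) *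
            (pochhammer (- of_nat k) m / pochhammer (a + d) m)))"
      by (subst sum.swap) (simp only: sum_distrib_left)
    also have "\<dots> = (\<Sum>m\<le>n. y m * (pochhammer (a + c) n / fact n * (pochhammer (- of_nat n) m / pochhammer (a + c) m)))"
      using pochhammer_Vandermonde_shifted[of _ n "a + d" "c - d"] nz by (intro sum.cong refl) simp
    also have "\<dots> = pochhammer (a + c) n / fact n * P c n"
      by (simp add: P sum_distrib_left mult_ac)
    finally have *: "(\<Sum>k\<le>n. pochhammer (a + d) k / fact k * P d k * (pochhammer (c - d) (n - k) / fact (n - k))) =
        pochhammer (a + c) n / fact n * P c n" .
    have "(\<Sum>k\<le>n. A k (n - k)) = pochhammer \<gamma> n / pochhammer (a + c) n * \<rho> ^ n *
        (\<Sum>k\<le>n. pochhammer (a + d) k / fact k * P d k * (pochhammer (c - d) (n - k) / fact (n - k)))"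
      unfolding sum_distrib_left by (intro sum.cong refl) (simp add: A_def mult_ac)
    then show ?thesis unfolding * using nz(2)[of n] by simp
  qed

  \<comment> \<open>Splitting |\<rho>|^(k+j) into u^(k+j) u^k u^j leaves one power to bound
    (\<gamma>)_(k+j)/(a+c)_(k+j) and one for each of the two summable factors.\<close>
  define u where "u = sqrt (norm \<rho>)"
  have u: "0 \<le> u" "u < 1" "norm \<rho> = u * u"
    using rho by (auto simp: u_def)
  have "summable (\<lambda>n. norm (pochhammer \<gamma> n / pochhammer (a + c) n) * u ^ n)"
    using pos u by (intro sums_norm_in_disc summable_pochhammer_quotient) auto
  then have "Bseq (\<lambda>n. norm (pochhammer \<gamma> n / pochhammer (a + c) n) * u ^ n)"
    by (intro convergent_imp_Bseq convergentI[OF summable_LIMSEQ_zero])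
  then obtain C where C: "\<And>n. norm (norm (pochhammer \<gamma> n / pochhammer (a + c) n) * u ^ n) \<le> C" "C > 0"
    unfolding Bseq_def by blast
  have bound: "norm (A k j) \<le> (C * (norm (pochhammer (a + d) k / fact k * P d k) * u ^ k)) *
      (norm (pochhammer (c - d) j / fact j) * u ^ j)" for k j
  proof -
    let ?r = "norm (pochhammer (a + d) k / fact k * P d k) * u ^ k * (norm (pochhammer (c - d) j / fact j) * u ^ j)"
    have "norm (A k j) = norm (pochhammer \<gamma> (k + j) / pochhammer (a + c) (k + j)) * u ^ (k + j) * ?r"
      unfolding A_def norm_mult norm_power u(3) power_mult_distrib by (simp only: power_add mult_ac)
    also have "\<dots> \<le> C * ?r"
      using C(1)[of "k + j"] u(1) by (intro mult_right_mono) auto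
    finally show ?thesis by (simp only: mult_ac)
  qed
  have "summable (\<lambda>n. pochhammer (c - d) n / fact n * s ^ n)" if "norm s < 1" for s
    using continuable_binomial[of "c - d"] that by (elim continuableE) (blast intro: sums_summable)
  then have summable_cd: "summable (\<lambda>j. norm (pochhammer (c - d) j / fact j) * u ^ j)"
    using u by (intro sums_norm_in_disc) auto
  have "(\<lambda>k. \<Sum>j. A k j) sums ((1 - \<rho>) powr (-\<gamma>) * f (\<rho> / (\<rho> - 1)))"
  proof (rule sums_regroup_diagonals[OF _ _ _ _ bound])
    have "summable (\<lambda>n. pochhammer (a + d) n / fact n * P d n * s ^ n)" if "norm s < 1" for s
      using transf[OF pos(4), of "a + d"] that sums_summable by blast
    then show "summable (\<lambda>k. C * (norm (pochhammer (a + d) k / fact k * P d k) * u ^ k))"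
      using u by (intro summable_mult sums_norm_in_disc) auto
    show "summable (\<lambda>j. norm (pochhammer (c - d) j / fact j) * u ^ j)"
      by (rule summable_cd)
    show "(\<lambda>n. \<Sum>k\<le>n. A k (n - k)) sums ((1 - \<rho>) powr (-\<gamma>) * f (\<rho> / (\<rho> - 1)))"
      unfolding diag by (rule f(3))
  qed (use u C in auto)
  also have "(\<lambda>k. \<Sum>j. A k j) = (\<lambda>k. pochhammer \<gamma> k * \<rho> ^ k /
              (pochhammer (a + b) k * pochhammer (a + c) k * fact k) *
            hypergeo [c - d, \<gamma> + of_nat k] [of_nat k + a + c] \<rho> *
            cont_dual_hahn k (of_real x) a b d)"
  proof
    fix k
    define K where "K = pochhammer \<gamma> k / pochhammer (a + c) k * \<rho> ^ k * (pochhammer (a + d) k / fact k * P d k)"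
    define h where "h j = pochhammer (c - d) j * pochhammer (\<gamma> + of_nat k) j / pochhammer (of_nat k + a + c) j *
        (\<rho> ^ j / fact j)" for j
    have A: "A k = (\<lambda>j. K * h j)"
      unfolding A_def K_def h_def pochhammer_product'
      by (simp add: power_add add_ac mult_ac)
    \<comment> \<open>Pulling \<open>K\<close> out of the sum needs summability of \<open>h\<close>,
      which is inferred from that of \<open>A k\<close> by dividing by \<open>K\<close>. For
      \<open>K = 0\<close> both sides are 0.\<close>
    have "summable h" if "K \<noteq> 0"
    proof -
      have "summable (A k)"
        by (rule summable_comparison_test'[OF summable_mult[OF summable_cd] bound])
      then show ?thesis using that by (simp add: A)
    qed
    then have "(\<Sum>j. A k j) = K * suminf h"
      by (cases "K = 0") (simp_all add: A suminf_mult)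
    moreover have "suminf h = hypergeo [c - d, \<gamma> + of_nat k] [of_nat k + a + c] \<rho>"
      using rho unfolding hypergeo_def hypergeo_series_sum h_def by simp
    moreover have "cont_dual_hahn k (of_real x) a b d = pochhammer (a + b) k * pochhammer (a + d) k * P d k"
      unfolding cont_dual_hahn_sum P_def v_def ..
    ultimately show "(\<Sum>j. A k j) = pochhammer \<gamma> k * \<rho> ^ k /
              (pochhammer (a + b) k * pochhammer (a + c) k * fact k) *
            hypergeo [c - d, \<gamma> + of_nat k] [of_nat k + a + c] \<rho> *
            cont_dual_hahn k (of_real x) a b d"
      using nz(1)[of k] by (simp add: K_def)
  qed
  finally show ?thesis unfolding lhs .
qed

end
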